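(* Let $T$ be a tree on $n \ge 2$ vertices. Then $\textrm{RED:LD}(T) = n$ if and only if every vertex of $T$ is a leaf or a support vertex.
   Context: A leaf is a vertex of degree 1; a support vertex is a vertex adjacent to a leaf. $N(v)$ denotes the open neighborhood of $v$. A set $S \subseteq V(G)$ is a locating-dominating (LD) set if for all $u,v \in V(G)-S$: $N(v)\cap S \neq \varnothing$, and if $u \ne v$ then $N(v) \cap S \neq N(u) \cap S$. A RED:LD set is an LD set $S$ such that $S-\{v\}$ is an LD set for every $v \in S$. $\textrm{RED:LD}(G)$ is the minimum cardinality of a RED:LD set of $G$. *)

theory Defs
  imports "Graph_Theory.Digraph_Component"
begin

text \<open>
  Finite simple undirected graphs are symmetric digraphs without loops and parallel arcs
  (locale \<^locale>\<open>graph\<close>): an undirected edge is a pair of opposite arcs, so the degree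
  of a vertex is its out-degree.
\<close>

text \<open>
  The library predicate \<^const>\<open>tree\<close> is not usable for symmetric digraphs, since there the two
  arcs of a single edge already form a directed cycle of length 2. In a symmetric digraph
  without loops and parallel arcs, the cycles of length at least 3 are exactly the cycles of
  the undirected graph.
\<close>

definition undirected_tree :: "('a, 'b) pre_digraph \<Rightarrow> bool" where
  "undirected_tree G \<longleftrightarrow>
     graph G \<and> Digraph_Component.connected G \<and> \<not> (\<exists>p. pre_digraph.cycle G p \<and> length p \<ge> 3)"

definition open_nbhd :: "('a, 'b) pre_digraph \<Rightarrow> 'a \<Rightarrow> 'a set" where
  "open_nbhd G v = {u \<in> verts G. v \<rightarrow>\<^bsub>G\<^esub> u}"

definition is_leaf :: "('a, 'b) pre_digraph \<Rightarrow> 'a \<Rightarrow> bool" where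
  "is_leaf G v \<longleftrightarrow> v \<in> verts G \<and> out_degree G v = 1"

definition is_support :: "('a, 'b) pre_digraph \<Rightarrow> 'a \<Rightarrow> bool" where
  "is_support G v \<longleftrightarrow> v \<in> verts G \<and> (\<exists>u. is_leaf G u \<and> v \<rightarrow>\<^bsub>G\<^esub> u)"

definition LD_set :: "('a, 'b) pre_digraph \<Rightarrow> 'a set \<Rightarrow> bool" where
  "LD_set G S \<longleftrightarrow> S \<subseteq> verts G \<and>
     (\<forall>u \<in> verts G - S. \<forall>v \<in> verts G - S.
        open_nbhd G v \<inter> S \<noteq> {} \<and>
        (u \<noteq> v \<longrightarrow> open_nbhd G v \<inter> S \<noteq> open_nbhd G u \<inter> S))"

definition RED_LD_set :: "('a, 'b) pre_digraph \<Rightarrow> 'a set \<Rightarrow> bool" where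
  "RED_LD_set G S \<longleftrightarrow> LD_set G S \<and> (\<forall>v \<in> S. LD_set G (S - {v}))"

definition RED_LD :: "('a, 'b) pre_digraph \<Rightarrow> nat" where
  "RED_LD G = Min (card ` {S. RED_LD_set G S})"

end

theory Submission
  imports Defs
begin

text \<open>
  If a leaf or its support vertex were missing from a RED:LD set, deleting the other one would
  leave the leaf undominated, so every RED:LD set contains all leaves and support vertices.
  Conversely, if \<open>v\<close> is neither, then \<open>verts T - {v}\<close> is a RED:LD set: if \<open>v\<close> and some \<open>x\<close>
  had the same neighbours in \<open>verts T - {v, x}\<close>, they would lie on a common triangle (if
  adjacent) or 4-cycle (if not).
\<close>

context graph
begin

lemma open_nbhd_subset: "open_nbhd G v \<subseteq> verts G"
  by (auto simp: open_nbhd_def)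

lemma mem_open_nbhd_iff: "u \<in> open_nbhd G v \<longleftrightarrow> v \<rightarrow>\<^bsub>G\<^esub> u"
  by (auto simp: open_nbhd_def)

lemma open_nbhd_sym: "u \<in> open_nbhd G v \<longleftrightarrow> v \<in> open_nbhd G u"
  unfolding mem_open_nbhd_iff by (blast intro: graph_symmetric)

lemma not_in_open_nbhd: "v \<notin> open_nbhd G v"
  using no_loops by (auto simp: mem_open_nbhd_iff arcs_ends_def arc_to_ends_def)

text \<open>Without parallel arcs, \<open>head\<close> maps the out-arcs of \<open>v\<close>
  bijectively onto its neighbours.\<close>

lemma out_degree_eq_card_open_nbhd: "out_degree G v = card (open_nbhd G v)"
proof -
  have "inj_on (head G) (out_arcs G v)"
    by (auto intro!: inj_onI no_multi_arcs simp: out_arcs_def arc_to_ends_def)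
  moreover have "head G ` out_arcs G v = open_nbhd G v"
    by (auto simp: out_arcs_def open_nbhd_def arcs_ends_def arc_to_ends_def)
  ultimately show ?thesis
    by (metis card_image out_degree_def)
qed

lemma is_leaf_iff: "is_leaf G v \<longleftrightarrow> v \<in> verts G \<and> (\<exists>w. open_nbhd G v = {w})"
  by (simp add: is_leaf_def out_degree_eq_card_open_nbhd card_1_singleton_iff)

text \<open>A leaf has exactly one neighbour, so by symmetry the support vertex is the only vertex
  that can dominate it from outside.\<close>

lemma is_support_iff: "is_support G v \<longleftrightarrow> (\<exists>u. is_leaf G u \<and> open_nbhd G u = {v})"
proof
  assume "is_support G v"
  then obtain u where "is_leaf G u" "v \<in> open_nbhd G u"
    unfolding is_support_def by (metis mem_open_nbhd_iff open_nbhd_sym)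
  then show "\<exists>u. is_leaf G u \<and> open_nbhd G u = {v}"
    by (auto simp: is_leaf_iff)
next
  assume "\<exists>u. is_leaf G u \<and> open_nbhd G u = {v}"
  then obtain u where "is_leaf G u" "v \<in> open_nbhd G u" by auto
  then show "is_support G v"
    unfolding is_support_def by (metis mem_open_nbhd_iff open_nbhd_subset open_nbhd_sym subsetD)
qed

text \<open>Symmetry upgrades connectedness to strong connectedness; the first arc of a path from
  \<open>v\<close> to another vertex leads to a neighbour.\<close>

lemma connected_imp_open_nbhd_nonempty:
  assumes "Digraph_Component.connected G" "card (verts G) \<ge> 2" "v \<in> verts G"
  shows "open_nbhd G v \<noteq> {}"
proof -
  have "verts G \<noteq> {v}" using assms(2) by auto
  then obtain w where w: "w \<in> verts G" "w \<noteq> v" using assms(3) by auto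
  have "strongly_connected G"
    using assms(1) sym_arcs symmetric_connected_imp_strongly_connected by blast
  then have "v \<rightarrow>\<^sup>*\<^bsub>G\<^esub> w" using assms(3) w by blast
  then show ?thesis
    using w(2) by (cases rule: converse_reachable_cases) (auto simp: mem_open_nbhd_iff[symmetric])
qed

lemma triangle_imp_cycle:
  assumes "b \<in> open_nbhd G a" "c \<in> open_nbhd G b" "a \<in> open_nbhd G c"
  shows "\<exists>p. cycle p \<and> length p = 3"
proof -
  obtain e f g where e: "e \<in> arcs G" "tail G e = a" "head G e = b"
    and f: "f \<in> arcs G" "tail G f = b" "head G f = c"
    and g: "g \<in> arcs G" "tail G g = c" "head G g = a"
    using assms by (auto simp: mem_open_nbhd_iff arcs_ends_def arc_to_ends_def)
  have "a \<noteq> b" "b \<noteq> c" "c \<noteq> a" using assms not_in_open_nbhd by blast+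
  moreover have "a \<in> verts G" using e by auto
  ultimately have "cycle [e, f, g]"
    unfolding cycle_def awalk_def using e f g by (intro exI[of _ a]) simp
  then show ?thesis by (intro exI[of _ "[e, f, g]"]) simp
qed

text \<open>Consecutive vertices differ because there are no loops; only the two diagonals need
  explicit distinctness.\<close>

lemma square_imp_cycle:
  assumes "b \<in> open_nbhd G a" "c \<in> open_nbhd G b" "d \<in> open_nbhd G c" "a \<in> open_nbhd G d"
    and "a \<noteq> c" "b \<noteq> d"
  shows "\<exists>p. cycle p \<and> length p = 4"
proof -
  obtain e f g h where e: "e \<in> arcs G" "tail G e = a" "head G e = b"
    and f: "f \<in> arcs G" "tail G f = b" "head G f = c"
    and g: "g \<in> arcs G" "tail G g = c" "head G g = d"
    and h: "h \<in> arcs G" "tail G h = d" "head G h = a"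
    using assms(1-4) by (auto simp: mem_open_nbhd_iff arcs_ends_def arc_to_ends_def)
  have "a \<noteq> b" "b \<noteq> c" "c \<noteq> d" "d \<noteq> a" using assms not_in_open_nbhd by blast+
  moreover have "a \<in> verts G" using e by auto
  ultimately have "cycle [e, f, g, h]"
    unfolding cycle_def awalk_def using e f g h assms(5,6) by (intro exI[of _ a]) auto
  then show ?thesis by (intro exI[of _ "[e, f, g, h]"]) simp
qed

lemma LD_set_dominates:
  assumes "LD_set G S" "v \<in> verts G" "v \<notin> S"
  shows "open_nbhd G v \<inter> S \<noteq> {}"
  using assms by (auto simp: LD_set_def)

text \<open>With one vertex outside the set there is no pair to separate, and since \<open>v\<close>
  is not its own neighbour, all its neighbours lie in the set.\<close>

lemma LD_set_Diff_singleton_iff: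
  assumes "v \<in> verts G"
  shows "LD_set G (verts G - {v}) \<longleftrightarrow> open_nbhd G v \<noteq> {}"
  using assms not_in_open_nbhd[of v] open_nbhd_subset[of v] by (auto simp: LD_set_def)

lemma RED_LD_set_contains_leaf_and_support:
  assumes S: "RED_LD_set G S" and leaf: "is_leaf G u" "open_nbhd G u = {v}"
  shows "u \<in> S" "v \<in> S"
proof -
  have u: "u \<in> verts G" using leaf(1) by (simp add: is_leaf_def)
  have LD: "LD_set G S" "\<And>w. w \<in> S \<Longrightarrow> LD_set G (S - {w})"
    using S by (auto simp: RED_LD_set_def)
  show "u \<in> S"
  proof (rule ccontr)
    assume "u \<notin> S"
    \<comment> \<open>Domination of \<open>u\<close> forces \<open>v\<close> into \<open>S\<close>,
      so \<open>v\<close> may be deleted, which leaves \<open>u\<close> undominated.\<close>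
    then have "v \<in> S" using LD_set_dominates[OF LD(1) u] leaf(2) by auto
    then show False using LD_set_dominates[OF LD(2) u] \<open>u \<notin> S\<close> leaf(2) by auto
  qed
  then show "v \<in> S" using LD_set_dominates[OF LD(2)[of u] u] leaf(2) by auto
qed

lemma RED_LD_set_verts:
  assumes "\<And>v. v \<in> verts G \<Longrightarrow> open_nbhd G v \<noteq> {}"
  shows "RED_LD_set G (verts G)"
  using assms by (auto simp: RED_LD_set_def LD_set_Diff_singleton_iff) (simp add: LD_set_def)

lemma RED_LD_set_Diff_singleton:
  assumes acyclic: "\<not> (\<exists>p. cycle p \<and> length p \<ge> 3)"
    and nonempty: "\<And>v. v \<in> verts G \<Longrightarrow> open_nbhd G v \<noteq> {}"
    and v: "v \<in> verts G" "\<not> is_leaf G v" "\<not> is_support G v"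
  shows "RED_LD_set G (verts G - {v})"
  unfolding RED_LD_set_def
proof (intro conjI ballI)
  show "LD_set G (verts G - {v})"
    using v nonempty by (simp add: LD_set_Diff_singleton_iff)
next
  fix x assume "x \<in> verts G - {v}"
  then have x: "x \<in> verts G" "x \<noteq> v" by auto
  have trace: "open_nbhd G v \<inter> (verts G - {v} - {x}) = open_nbhd G v - {x}"
    "open_nbhd G x \<inter> (verts G - {v} - {x}) = open_nbhd G x - {v}"
    using open_nbhd_subset[of v] open_nbhd_subset[of x] not_in_open_nbhd[of v] not_in_open_nbhd[of x]
    by auto
  \<comment> \<open>As \<open>v\<close> is not a leaf, \<open>x\<close> cannot be its only
    neighbour.\<close>
  have dom_v: "open_nbhd G v - {x} \<noteq> {}"
    using v(1,2) nonempty[OF v(1)] by (auto simp: is_leaf_iff)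
  \<comment> \<open>If \<open>v\<close> were the only neighbour of \<open>x\<close>, then
    \<open>x\<close> would be a leaf and \<open>v\<close> its support vertex.\<close>
  have dom_x: "open_nbhd G x - {v} \<noteq> {}"
    using x(1) v(3) nonempty[OF x(1)] by (auto simp: is_support_iff is_leaf_iff)
  have sep: "open_nbhd G v - {x} \<noteq> open_nbhd G x - {v}"
  proof
    assume eq: "open_nbhd G v - {x} = open_nbhd G x - {v}"
    obtain w where w: "w \<in> open_nbhd G v" "w \<in> open_nbhd G x"
      using dom_v eq by blast
    show False
    proof (cases "x \<in> open_nbhd G v")
      case True
      then show False
        using triangle_imp_cycle[of v x w] w open_nbhd_sym acyclic by (metis order_refl)
    next
      case False
      \<comment> \<open>Since \<open>v\<close> is not a leaf, it has a second neighbour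
        \<open>w'\<close>; it differs from \<open>x\<close> by non-adjacency, so \<open>eq\<close>
        makes it a common neighbour and v, w, x, w' form a 4-cycle.\<close>
      obtain w' where "w' \<in> open_nbhd G v" "w' \<noteq> w"
        using v(1,2) w(1) by (auto simp: is_leaf_iff)
      moreover from this have "w' \<in> open_nbhd G x" using False eq by blast
      ultimately show False
        using square_imp_cycle[of w v x w'] w x(2) open_nbhd_sym[of w] open_nbhd_sym[of w'] acyclic
        by fastforce
    qed
  qed
  have "verts G - (verts G - {v} - {x}) = {v, x}" using v(1) x(1) by auto
  then show "LD_set G (verts G - {v} - {x})"
    using trace dom_v dom_x sep by (auto simp: LD_set_def)
qed

text \<open>\<open>Min\<close> gives a lower bound only for finite sets.\<close>

lemma finite_RED_LD_sets: "finite {S. RED_LD_set G S}"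
  by (rule finite_subset[of _ "Pow (verts G)"]) (auto simp: RED_LD_set_def LD_set_def)

lemma RED_LD_le:
  assumes "RED_LD_set G S"
  shows "RED_LD G \<le> card S"
  using assms finite_RED_LD_sets by (auto simp: RED_LD_def)

end

theorem theorem9:
  fixes T :: "('a, 'b) pre_digraph" and n :: nat
  assumes "undirected_tree T" and "card (verts T) = n" and "n \<ge> 2"
  shows "RED_LD T = n \<longleftrightarrow> (\<forall>v \<in> verts T. is_leaf T v \<or> is_support T v)"
proof -
  interpret graph T using assms(1) by (simp add: undirected_tree_def)
  have acyclic: "\<not> (\<exists>p. cycle p \<and> length p \<ge> 3)"
    using assms(1) by (simp add: undirected_tree_def)
  have nonempty: "open_nbhd T v \<noteq> {}" if "v \<in> verts T" for v
    using connected_imp_open_nbhd_nonempty that assms by (simp add: undirected_tree_def)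
  show ?thesis
  proof
    assume *: "RED_LD T = n"
    show "\<forall>v \<in> verts T. is_leaf T v \<or> is_support T v"
    proof (rule ccontr)
      assume "\<not> ?thesis"
      then obtain v where v: "v \<in> verts T" "\<not> is_leaf T v" "\<not> is_support T v" by auto
      have "RED_LD T \<le> card (verts T - {v})"
        by (rule RED_LD_le) (rule RED_LD_set_Diff_singleton[OF acyclic nonempty v])
      also have "\<dots> < n"
        using v(1) assms(2) by (metis card_Diff1_less finite_verts)
      finally show False using * by simp
    qed
  next
    assume *: "\<forall>v \<in> verts T. is_leaf T v \<or> is_support T v"
    \<comment> \<open>Every vertex is now forced into \<open>S\<close>, so the minimum is taken over
      a single set.\<close>
    have "S = verts T" if "RED_LD_set T S" for S
    proof
      show "S \<subseteq> verts T" using that by (simp add: RED_LD_set_def LD_set_def)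
      show "verts T \<subseteq> S"
        using * RED_LD_set_contains_leaf_and_support[OF that]
        unfolding is_support_iff by (metis is_leaf_iff subsetI)
    qed
    then have "{S. RED_LD_set T S} = {verts T}"
      using RED_LD_set_verts[OF nonempty] by blast
    then show "RED_LD T = n" by (simp add: RED_LD_def assms(2))
  qed
qed

end
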